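(* Let $\mathcal{C}\subseteq\mathbb{Z}_2^\alpha\times R^\beta$ be a $\mathbb{Z}_2R$ linear self-dual code with $\alpha\cdot\beta>0$. (i) If $\mathcal{C}$ is Type I and separable, then $\alpha\geq 2$ and $\beta\geq 1$. (ii) If $\mathcal{C}$ is Type I and non-separable, then $\alpha\geq 4$ and $\beta\geq 2$. (iii) If $\mathcal{C}$ is Type II, then $\alpha\geq 4$ and $\beta\geq 2$.
   Context: Let $R=\mathbb{Z}_2+u\mathbb{Z}_2=\{0,1,u,1+u\}$ with $u^2=0$, and $\eta:R\to\mathbb{Z}_2$, $\eta(r+uq)=r$. The set $\mathbb{Z}_2^\alpha\times R^\beta$ is an $R$-module under $d(a_1,\dots,a_\alpha\mid b_1,\dots,b_\beta)=(\eta(d)a_1,\dots,\eta(d)a_\alpha\mid db_1,\dots,db_\beta)$. A $\mathbb{Z}_2R$ linear code is an $R$-submodule $\mathcal{C}$ of $\mathbb{Z}_2^\alpha\times R^\beta$. The inner product is $\langle(\mathbf v|\mathbf w),(\mathbf x|\mathbf y)\rangle=u\sum_{i=1}^\alpha v_ix_i+\sum_{j=1}^\beta w_jy_j\in R$; $\mathcal{C}^\perp$ is the set of vectors orthogonal to all of $\mathcal{C}$; $\mathcal{C}$ is self-dual if $\mathcal{C}=\mathcal{C}^\perp$. The Lee weight on $R$ is $wt_L(0)=0$, $wt_L(1)=wt_L(1+u)=1$, $wt_L(u)=2$, extended additively to $R^\beta$, and $wt_L(\mathbf v|\mathbf w)=wt_H(\mathbf v)+wt_L(\mathbf w)$, where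 $wt_H$ is the Hamming weight. A self-dual code is Type I if it has only even Lee weights, and Type II if all its codewords have doubly-even Lee weight (divisible by $4$). Let $\mathcal{C}_X\subseteq\mathbb{Z}_2^\alpha$ and $\mathcal{C}_Y\subseteq R^\beta$ be the projections of $\mathcal{C}$ onto the first $\alpha$ and last $\beta$ coordinates; $\mathcal{C}$ is separable if $\mathcal{C}=\mathcal{C}_X\times\mathcal{C}_Y$, and non-separable otherwise. *)

theory Defs
  imports "HOL-Library.Z2" "Jordan_Normal_Form.Matrix"
begin

text \<open>The ring \<open>R = \<int>\<^sub>2 + u\<int>\<^sub>2\<close> with \<open>u\<^sup>2 = 0\<close>: \<open>Z2u r q\<close> stands for \<open>r + uq\<close>, so the
  selector \<open>eta\<close> is the reduction map \<open>r + uq \<mapsto> r\<close>.\<close>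

datatype z2u = Z2u (eta: bit) (ucoeff: bit)

instantiation z2u :: comm_ring_1
begin

definition "0 = Z2u 0 0"
definition "1 = Z2u 1 0"
definition "x + y = Z2u (eta x + eta y) (ucoeff x + ucoeff y)"
definition "- x = Z2u (- eta x) (- ucoeff x)"
definition "x - y = Z2u (eta x - eta y) (ucoeff x - ucoeff y)"
definition "x * y = Z2u (eta x * eta y) (eta x * ucoeff y + ucoeff x * eta y)"

instance
  by standard
    (simp_all only: zero_z2u_def one_z2u_def plus_z2u_def uminus_z2u_def minus_z2u_def
      times_z2u_def z2u.sel z2u.inject z2u.collapse ring_distribs ac_simps diff_conv_add_uminus
      add_0_left add_0_right add.right_inverse mult_1_left mult_zero_left zero_neq_one
      simp_thms)

end

definition u :: z2u where
  "u = Z2u 0 1"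

lemma eta_hom: "eta 1 = 1" "eta (x + y) = eta x + eta y" "eta (x * y) = eta x * eta y"
  by (simp_all add: one_z2u_def plus_z2u_def times_z2u_def)

lemma u_squared: "u * u = 0"
  by (simp add: u_def times_z2u_def zero_z2u_def)

lemma Z2u_eq: "Z2u r q = Z2u r 0 + u * Z2u q 0"
  by (simp add: u_def times_z2u_def plus_z2u_def)

lemma UNIV_z2u: "(UNIV :: z2u set) = {0, 1, u, 1 + u}"
proof -
  have "x \<in> {0, 1, u, 1 + u}" for x
    by (cases x; cases "eta x"; cases "ucoeff x")
      (simp_all add: zero_z2u_def one_z2u_def u_def plus_z2u_def)
  then show ?thesis by blast
qed

definition z2u_ring :: "z2u ring" where
  "z2u_ring = \<lparr>carrier = UNIV, mult = (*), one = 1, zero = 0, add = (+)\<rparr>"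

text \<open>The \<open>R\<close>-module \<open>\<int>\<^sub>2\<^sup>\<alpha> \<times> R\<^sup>\<beta>\<close>. The record type for modules extends that for rings; the
  fields \<open>mult\<close> and \<open>one\<close> have no meaning for a module.\<close>

definition ambient :: "nat \<Rightarrow> nat \<Rightarrow> (z2u, bit vec \<times> z2u vec) module" where
  "ambient \<alpha> \<beta> = \<lparr>
    carrier = carrier_vec \<alpha> \<times> carrier_vec \<beta>,
    mult = undefined,
    one = undefined,
    zero = (0\<^sub>v \<alpha>, 0\<^sub>v \<beta>),
    add = (\<lambda>(a, b) (a', b'). (a + a', b + b')),
    smult = (\<lambda>d (a, b). (eta d \<cdot>\<^sub>v a, d \<cdot>\<^sub>v b))\<rparr>"

lemma cring_z2u_ring: "cring z2u_ring"
proof (rule cringI)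
  show "abelian_group z2u_ring"
  proof (rule abelian_groupI)
    fix x assume "x \<in> carrier z2u_ring"
    show "\<exists>y\<in>carrier z2u_ring. y \<oplus>\<^bsub>z2u_ring\<^esub> x = \<zero>\<^bsub>z2u_ring\<^esub>"
      by (rule bexI[of _ "- x"]) (simp_all add: z2u_ring_def)
  qed (simp_all add: z2u_ring_def algebra_simps)
  show "comm_monoid z2u_ring"
    by (rule comm_monoidI) (simp_all add: z2u_ring_def algebra_simps)
qed (simp add: z2u_ring_def algebra_simps)

lemma module_ambient: "module z2u_ring (ambient \<alpha> \<beta>)"
proof (rule moduleI[OF cring_z2u_ring])
  show "abelian_group (ambient \<alpha> \<beta>)"
  proof (rule abelian_groupI)
    fix x assume "x \<in> carrier (ambient \<alpha> \<beta>)"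
    then show "\<exists>y\<in>carrier (ambient \<alpha> \<beta>). y \<oplus>\<^bsub>ambient \<alpha> \<beta>\<^esub> x = \<zero>\<^bsub>ambient \<alpha> \<beta>\<^esub>"
      by (intro bexI[of _ "(- fst x, - snd x)"]) (auto simp: ambient_def)
  qed (auto simp: ambient_def comm_add_vec)
qed (auto simp: ambient_def z2u_ring_def eta_hom add_smult_distrib_vec smult_add_distrib_vec
       smult_smult_assoc)

definition linear_code :: "nat \<Rightarrow> nat \<Rightarrow> (bit vec \<times> z2u vec) set \<Rightarrow> bool" where
  "linear_code \<alpha> \<beta> C \<longleftrightarrow> submodule C z2u_ring (ambient \<alpha> \<beta>)"

text \<open>\<open>\<int>\<^sub>2\<close> is the subring \<open>{Z2u 0 0, Z2u 1 0}\<close> of \<open>R\<close>, so the sum \<open>\<Sum> v\<^sub>i x\<^sub>i\<close> can be formed in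
  \<open>\<int>\<^sub>2\<close> before it is embedded in \<open>R\<close> and multiplied by \<open>u\<close>.\<close>

definition inner :: "bit vec \<times> z2u vec \<Rightarrow> bit vec \<times> z2u vec \<Rightarrow> z2u" where
  "inner x y = u * Z2u (fst x \<bullet> fst y) 0 + snd x \<bullet> snd y"

definition dual :: "nat \<Rightarrow> nat \<Rightarrow> (bit vec \<times> z2u vec) set \<Rightarrow> (bit vec \<times> z2u vec) set" where
  "dual \<alpha> \<beta> C = {x \<in> carrier (ambient \<alpha> \<beta>). \<forall>c\<in>C. inner x c = 0}"

definition self_dual :: "nat \<Rightarrow> nat \<Rightarrow> (bit vec \<times> z2u vec) set \<Rightarrow> bool" where
  "self_dual \<alpha> \<beta> C \<longleftrightarrow> C = dual \<alpha> \<beta> C"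

definition hamming_weight :: "bit vec \<Rightarrow> nat" where
  "hamming_weight v = card {i. i < dim_vec v \<and> v $ i \<noteq> 0}"

definition lee_weight_R :: "z2u \<Rightarrow> nat" where
  "lee_weight_R x = (if x = 0 then 0 else if x = u then 2 else 1)"

definition lee_weight :: "bit vec \<times> z2u vec \<Rightarrow> nat" where
  "lee_weight x = hamming_weight (fst x) + (\<Sum>j<dim_vec (snd x). lee_weight_R (snd x $ j))"

text \<open>As defined here, Type I asks only that all Lee weights be even; Type II codes are not
  excluded.\<close>

definition type_I :: "nat \<Rightarrow> nat \<Rightarrow> (bit vec \<times> z2u vec) set \<Rightarrow> bool" where
  "type_I \<alpha> \<beta> C \<longleftrightarrow> self_dual \<alpha> \<beta> C \<and> (\<forall>c\<in>C. even (lee_weight c))"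

definition type_II :: "nat \<Rightarrow> nat \<Rightarrow> (bit vec \<times> z2u vec) set \<Rightarrow> bool" where
  "type_II \<alpha> \<beta> C \<longleftrightarrow> self_dual \<alpha> \<beta> C \<and> (\<forall>c\<in>C. 4 dvd lee_weight c)"

definition separable :: "(bit vec \<times> z2u vec) set \<Rightarrow> bool" where
  "separable C \<longleftrightarrow> C = (fst ` C) \<times> (snd ` C)"

end

theory Submission
  imports Defs
begin

text \<open>For a codeword \<open>c = (v | w)\<close> the equation \<open>\<langle>c, c\<rangle> = 0\<close> says that \<open>v\<close> has even weight and
  \<open>w\<close> has an even number of unit entries. Hence \<open>(1,\<dots>,1 | 0)\<close> and \<open>(0 | u,\<dots>,u)\<close> are orthogonal
  to the code, so they belong to it; their Lee weights are \<open>\<alpha>\<close> and \<open>2\<beta>\<close>, which settles the Type II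
  case and shows that \<open>\<alpha>\<close> is even. If \<open>\<alpha> = 2\<close> or \<open>\<beta> = 1\<close>, parity confines one of the two
  projections to \<open>{00, 11}\<close> or \<open>{0, u}\<close>, which is orthogonal to itself, and this forces the code
  to split.\<close>

lemma eta_sum: "eta (sum f A) = (\<Sum>i\<in>A. eta (f i))"
  by (induction A rule: infinite_finite_induct) (simp_all add: zero_z2u_def plus_z2u_def)

lemma ucoeff_sum: "ucoeff (sum f A) = (\<Sum>i\<in>A. ucoeff (f i))"
  by (induction A rule: infinite_finite_induct) (simp_all add: zero_z2u_def plus_z2u_def)

text \<open>Squaring fixes each bit, and (r + uq)^2 = r, because the cross term 2urq vanishes in
  characteristic 2 and u^2 = 0. So the R-part of the self-product lies in the \<open>eta\<close>
  component and the factor u puts the binary part in the \<open>ucoeff\<close> component: the two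
  cannot cancel each other.\<close>

lemma inner_self:
  "inner c c = Z2u (\<Sum>j<dim_vec (snd c). eta (snd c $ j)) (\<Sum>i<dim_vec (fst c). fst c $ i)"
proof -
  have "a * a = a" for a :: bit
    by (cases a) simp_all
  then have fst_sq: "fst c \<bullet> fst c = (\<Sum>i<dim_vec (fst c). fst c $ i)"
    by (simp add: scalar_prod_def atLeast0LessThan)
  have "a * a = Z2u (eta a) 0" for a :: z2u
    by (cases "eta a"; cases "ucoeff a") (simp_all add: times_z2u_def)
  then have "snd c \<bullet> snd c = Z2u (\<Sum>j<dim_vec (snd c). eta (snd c $ j)) 0"
    by (intro z2u.expand) (simp add: scalar_prod_def atLeast0LessThan eta_sum ucoeff_sum)
  with fst_sq show ?thesis
    by (simp add: inner_def u_def plus_z2u_def times_z2u_def)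
qed

lemma mem_self_dual_iff:
  assumes "self_dual \<alpha> \<beta> C"
  shows "(v, w) \<in> C \<longleftrightarrow> v \<in> carrier_vec \<alpha> \<and> w \<in> carrier_vec \<beta> \<and> (\<forall>c\<in>C. inner (v, w) c = 0)"
proof -
  have "C = dual \<alpha> \<beta> C"
    using assms by (simp add: self_dual_def)
  then show ?thesis
    by (subst \<open>C = dual \<alpha> \<beta> C\<close>) (auto simp: dual_def ambient_def)
qed

lemma self_dual_parity:
  assumes "self_dual \<alpha> \<beta> C" and "(v, w) \<in> C"
  shows "(\<Sum>i<\<alpha>. v $ i) = 0" and "(\<Sum>j<\<beta>. eta (w $ j)) = 0"
proof -
  have "dim_vec v = \<alpha>" "dim_vec w = \<beta>" "inner (v, w) (v, w) = 0"
    using assms by (auto simp: mem_self_dual_iff)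
  then show "(\<Sum>i<\<alpha>. v $ i) = 0" "(\<Sum>j<\<beta>. eta (w $ j)) = 0"
    by (simp_all add: inner_self zero_z2u_def)
qed

lemma all_ones_mem_self_dual:
  assumes sd: "self_dual \<alpha> \<beta> C"
  shows "(vec \<alpha> (\<lambda>_. 1), 0\<^sub>v \<beta>) \<in> C"
proof -
  have "inner (vec \<alpha> (\<lambda>_. 1), 0\<^sub>v \<beta>) (v, w) = 0" if c: "(v, w) \<in> C" for v w
  proof -
    have v: "v \<in> carrier_vec \<alpha>" and w: "w \<in> carrier_vec \<beta>"
      using c by (simp_all add: mem_self_dual_iff[OF sd])
    \<comment> \<open>The binary part of the pairing is the coordinate sum of v, which is zero by
      parity.\<close>
    have "vec \<alpha> (\<lambda>_. 1) \<bullet> v = (\<Sum>i<\<alpha>. v $ i)"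
      unfolding scalar_prod_def carrier_vecD[OF v] by (rule sum.cong) auto
    then show ?thesis
      using w self_dual_parity(1)[OF sd c]
      by (simp add: inner_def u_def zero_z2u_def times_z2u_def plus_z2u_def)
  qed
  then show ?thesis
    by (auto simp: mem_self_dual_iff[OF sd])
qed

lemma all_u_mem_self_dual:
  assumes sd: "self_dual \<alpha> \<beta> C"
  shows "(0\<^sub>v \<alpha>, vec \<beta> (\<lambda>_. u)) \<in> C"
proof -
  have "inner (0\<^sub>v \<alpha>, vec \<beta> (\<lambda>_. u)) (v, w) = 0" if c: "(v, w) \<in> C" for v w
  proof -
    have v: "v \<in> carrier_vec \<alpha>" and w: "w \<in> carrier_vec \<beta>"
      using c by (simp_all add: mem_self_dual_iff[OF sd])
    have "vec \<beta> (\<lambda>_. u) \<bullet> w = (\<Sum>j<\<beta>. u * w $ j)"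
      unfolding scalar_prod_def carrier_vecD[OF w] by (rule sum.cong) auto
    also have "\<dots> = u * (\<Sum>j<\<beta>. w $ j)"
      by (simp add: sum_distrib_left)
    \<comment> \<open>Multiplication by u sees only the \<open>eta\<close> part of the sum, as u^2 =
      0.\<close>
    also have "\<dots> = 0"
      using self_dual_parity(2)[OF sd c] by (simp add: times_z2u_def zero_z2u_def u_def eta_sum)
    finally show ?thesis
      using v by (simp add: inner_def u_def zero_z2u_def times_z2u_def plus_z2u_def)
  qed
  then show ?thesis
    by (auto simp: mem_self_dual_iff[OF sd])
qed

lemma lee_weight_all_ones: "lee_weight (vec \<alpha> (\<lambda>_. 1), 0\<^sub>v \<beta>) = \<alpha>"
proof -
  have "{i. i < \<alpha> \<and> vec \<alpha> (\<lambda>_. 1 :: bit) $ i \<noteq> 0} = {..<\<alpha>}"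
    by auto
  then show ?thesis
    by (simp add: lee_weight_def hamming_weight_def lee_weight_R_def)
qed

lemma lee_weight_all_u: "lee_weight (0\<^sub>v \<alpha>, vec \<beta> (\<lambda>_. u)) = 2 * \<beta>"
proof -
  have "{i. i < \<alpha> \<and> 0\<^sub>v \<alpha> $ i \<noteq> (0 :: bit)} = {}"
    by auto
  moreover have "u \<noteq> 0"
    by (simp add: u_def zero_z2u_def)
  ultimately show ?thesis
    by (simp add: lee_weight_def hamming_weight_def lee_weight_R_def)
qed

text \<open>The two summands of \<open>inner\<close> add up to 0 on any pair of codewords, so if one
  vanishes, both do. The halves of different codewords can then be recombined: the result is still
  orthogonal to C, hence in C by self-duality.\<close>

lemma separableI:
  assumes sd: "self_dual \<alpha> \<beta> C"
    and orth: "\<And>v w v' w'. (v, w) \<in> C \<Longrightarrow> (v', w') \<in> C \<Longrightarrow> v \<bullet> v' = 0 \<or> w \<bullet> w' = 0"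
  shows "separable C"
proof -
  have both: "u * Z2u (v \<bullet> v') 0 = 0 \<and> w \<bullet> w' = 0" if "(v, w) \<in> C" "(v', w') \<in> C" for v w v' w'
  proof -
    have "u * Z2u (v \<bullet> v') 0 + w \<bullet> w' = 0"
      using that by (auto simp: mem_self_dual_iff[OF sd, of v] inner_def)
    moreover have "u * Z2u 0 0 = 0"
      by (simp add: u_def zero_z2u_def times_z2u_def)
    ultimately show ?thesis
      using orth[OF that] by auto
  qed
  have "(v, w') \<in> C" if "(v, w) \<in> C" "(v', w') \<in> C" for v w v' w'
  proof -
    \<comment> \<open>The first summand comes from the pair (v, w), (x, y), the second from (v',
      w'), (x, y); each is zero by itself.\<close>
    have "inner (v, w') (x, y) = 0" if "(x, y) \<in> C" for x y
      using both[OF \<open>(v, w) \<in> C\<close> that] both[OF \<open>(v', w') \<in> C\<close> that] by (simp add: inner_def)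
    then show ?thesis
      using that by (auto simp: mem_self_dual_iff[OF sd])
  qed
  then show ?thesis
    by (force simp: separable_def)
qed

text \<open>Even parity makes the two entries of each binary half equal, so the two terms of
  \<open>v \<bullet> v'\<close> coincide and cancel.\<close>

lemma separable_if_alpha_2:
  assumes sd: "self_dual 2 \<beta> C"
  shows "separable C"
proof (rule separableI[OF sd])
  fix v w v' w' assume c: "(v, w) \<in> C" "(v', w') \<in> C"
  have "v $ 0 + v $ 1 = 0" "v' $ 0 + v' $ 1 = 0"
    using c[THEN self_dual_parity(1)[OF sd]] by (simp_all add: numeral_2_eq_2)
  moreover have "v \<bullet> v' = v $ 0 * v' $ 0 + v $ 1 * v' $ 1"
  proof -
    have "dim_vec v' = 2"
      using c(2) by (auto simp: mem_self_dual_iff[OF sd])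
    then show ?thesis
      unfolding scalar_prod_def by (simp only: numeral_2_eq_2 sum.atLeast0_lessThan_Suc) simp
  qed
  ultimately show "v \<bullet> v' = 0 \<or> w \<bullet> w' = 0"
    by (cases "v $ 0"; cases "v $ 1"; cases "v' $ 0"; cases "v' $ 1") auto
qed

text \<open>Parity of a single entry means that it is a multiple of u, and a product of two such
  entries contains u^2 = 0.\<close>

lemma separable_if_beta_1:
  assumes sd: "self_dual \<alpha> 1 C"
  shows "separable C"
proof (rule separableI[OF sd])
  fix v w v' w' assume c: "(v, w) \<in> C" "(v', w') \<in> C"
  have "eta (w $ 0) = 0" "eta (w' $ 0) = 0"
    using c[THEN self_dual_parity(2)[OF sd]] by simp_all
  moreover have "w \<bullet> w' = w $ 0 * w' $ 0"
    using c(2) by (auto simp: mem_self_dual_iff[OF sd] scalar_prod_def)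
  ultimately show "v \<bullet> v' = 0 \<or> w \<bullet> w' = 0"
    by (simp add: times_z2u_def zero_z2u_def)
qed

theorem theorem2p18:
  fixes \<alpha> \<beta> :: nat and C :: "(bit vec \<times> z2u vec) set"
  assumes "\<alpha> * \<beta> > 0"
    and "linear_code \<alpha> \<beta> C"
    and "self_dual \<alpha> \<beta> C"
  shows "(type_I \<alpha> \<beta> C \<and> separable C \<longrightarrow> \<alpha> \<ge> 2 \<and> \<beta> \<ge> 1) \<and>
         (type_I \<alpha> \<beta> C \<and> \<not> separable C \<longrightarrow> \<alpha> \<ge> 4 \<and> \<beta> \<ge> 2) \<and>
         (type_II \<alpha> \<beta> C \<longrightarrow> \<alpha> \<ge> 4 \<and> \<beta> \<ge> 2)"
proof -
  have pos: "\<alpha> > 0" "\<beta> > 0"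
    using assms(1) by simp_all
  have I: "even \<alpha>" if "type_I \<alpha> \<beta> C"
    using that all_ones_mem_self_dual[OF assms(3)] lee_weight_all_ones[of \<alpha> \<beta>]
    by (force simp: type_I_def)
  have II: "4 dvd \<alpha>" "4 dvd 2 * \<beta>" if "type_II \<alpha> \<beta> C"
    using that all_ones_mem_self_dual[OF assms(3)] lee_weight_all_ones[of \<alpha> \<beta>]
      all_u_mem_self_dual[OF assms(3)] lee_weight_all_u[of \<alpha> \<beta>]
    by (force simp: type_II_def)+
  have nonsep: "\<alpha> \<noteq> 2 \<and> \<beta> \<noteq> 1" if "\<not> separable C"
    using that assms(3) separable_if_alpha_2 separable_if_beta_1 by blast
  show ?thesis
  proof (intro conjI impI; (elim conjE)?)
    show "\<alpha> \<ge> 2" if "type_I \<alpha> \<beta> C"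
      using I[OF that] pos by presburger
    show "\<beta> \<ge> 1"
      using pos by simp
    show "\<alpha> \<ge> 4" if "type_I \<alpha> \<beta> C" "\<not> separable C"
      \<comment> \<open>A positive even number other than 2 is at least 4.\<close>
      using I[OF that(1)] nonsep[OF that(2)] pos by presburger
    show "\<beta> \<ge> 2" if "\<not> separable C"
      using nonsep[OF that] pos by simp
    show "\<alpha> \<ge> 4" "\<beta> \<ge> 2" if "type_II \<alpha> \<beta> C"
      \<comment> \<open>Divisibility of 2\<beta> by 4 makes \<beta> even; positivity then gives both
        bounds.\<close>
      using II[OF that] pos by presburger+
  qed
qed

end
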